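(* Let $n\geqslant 1$ and $k\geqslant 1$ be integers with $\gcd(n,k)=1$. Then $$R_k(n)=\frac{n-1}{2}-\sum_{d\mid n,\ d\neq 1}\frac{\varphi(d)\,I(l_k(d))}{2\,l_k(d)}.$$
   Context: A set $A\subset \mathbb{Z}/n\mathbb{Z}$ is called $k$-free if for all $x\in A$, $kx\notin A$ (in particular an $x$ with $kx=x$ can never belong to a $k$-free set). $R_k(n)$ denotes the maximal cardinality of a $k$-free subset of $\mathbb{Z}/n\mathbb{Z}$. For an integer $d$ coprime to $k$, $l_k(d)$ is the multiplicative order of $k$ in $(\mathbb{Z}/d\mathbb{Z})^*$. $I$ is the indicator function of the odd integers ($I(t)=1$ if $t$ is odd, $0$ otherwise), and $\varphi$ is Euler's totient function. *)

theory Defs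
  imports "HOL-Number_Theory.Number_Theory" "HOL-Library.Indicator_Function"
begin

(* residue_ring n models Z/nZ on the canonical representatives 0, ..., n - 1. *)

definition k_free :: "nat \<Rightarrow> nat \<Rightarrow> int set \<Rightarrow> bool" where
  "k_free k n A \<longleftrightarrow>
     A \<subseteq> carrier (residue_ring (int n)) \<and> (\<forall>x\<in>A. (int k * x) mod int n \<notin> A)"

(* For n >= 1 the maximum is over a finite nonempty set: the empty set is k-free. *)
definition max_k_free :: "nat \<Rightarrow> nat \<Rightarrow> nat" where
  "max_k_free k n = Max (card ` {A. k_free k n A})"

end

theory Submission
  imports Defs "HOL-Combinatorics.Orbits"
begin

text \<open>
  As \<open>k\<close> is invertible modulo \<open>n\<close>, multiplication by \<open>k\<close> permutes the residues, and a \<open>k\<close>-free set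
  is one that contains no two consecutive points of a cycle. A cycle of length \<open>L\<close> contributes
  at most \<open>L div 2\<close> points, and this is attained; hence each residue has weight \<open>(L div 2) / L\<close>, with \<open>L\<close>
  the length of its cycle. The residue \<open>y\<close> lies on a cycle of length \<open>ord d k\<close>, where
  \<open>d = n div gcd y n\<close>, and each divisor \<open>d\<close> of \<open>n\<close> arises from \<open>totient d\<close> residues.
\<close>

section \<open>Orbits of a permutation of a finite set\<close>

lemma orbit_eq_iff_permutes:
  assumes "f permutes S" "finite S"
  shows "orbit f x = orbit f y \<longleftrightarrow> x \<in> orbit f y"
  using cyclic_on_orbit[OF assms] permutation_self_in_orbit assms
  by (metis orbit_cyclic_eq3 permutation_permutes)

lemma fibre_orbit_permutes:
  assumes "f permutes S" "finite S" "C \<in> orbit f ` S"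
  shows "{x \<in> S. orbit f x = C} = C"
  using assms permutes_orbit_subset[OF assms(1)] orbit_eq_iff_permutes[OF assms(1,2)] by blast

lemma card_subset_eq_sum_orbits:
  assumes "f permutes S" "finite S" "A \<subseteq> S"
  shows "card A = (\<Sum>C\<in>orbit f ` S. card (A \<inter> C))"
proof -
  have fin: "finite A" using assms finite_subset by blast
  have eq: "{x \<in> A. orbit f x = C} = A \<inter> C" if "C \<in> orbit f ` S" for C
    using fibre_orbit_permutes[OF assms(1,2) that] assms(3) by blast
  have "card A = (\<Sum>C\<in>orbit f ` S. \<Sum>x | x \<in> A \<and> orbit f x = C. 1)"
    using fin assms by (subst sum.group) auto
  also have "\<dots> = (\<Sum>C\<in>orbit f ` S. card (A \<inter> C))"
    using eq by (intro sum.cong) auto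
  finally show ?thesis .
qed

text \<open>The value of an orbit is spread evenly over its points. This trades a sum over cycles
  for one over residues, where cycle lengths can be computed pointwise.\<close>

lemma sum_orbits_eq_sum:
  fixes h :: "nat \<Rightarrow> real"
  assumes "f permutes S" "finite S"
  shows "(\<Sum>C\<in>orbit f ` S. h (card C)) =
    (\<Sum>x\<in>S. h (card (orbit f x)) / real (card (orbit f x)))"
proof -
  have "(\<Sum>x\<in>S. h (card (orbit f x)) / real (card (orbit f x))) =
    (\<Sum>C\<in>orbit f ` S. \<Sum>x | x \<in> S \<and> orbit f x = C. h (card (orbit f x)) / real (card (orbit f x)))"
    using assms(2) by (rule sum.image_gen)
  also have "\<dots> = (\<Sum>C\<in>orbit f ` S. h (card C))"
  proof (intro sum.cong refl)
    fix C assume C: "C \<in> orbit f ` S"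
    have "finite C" "C \<noteq> {}"
      using C assms permutes_orbit_subset[OF assms(1)] orbit_nonempty[of f]
      by (auto intro: finite_subset)
    hence "card C \<noteq> 0" by simp
    have "(\<Sum>x | x \<in> S \<and> orbit f x = C. h (card (orbit f x)) / real (card (orbit f x))) =
        (\<Sum>x\<in>C. h (card C) / real (card C))"
      using fibre_orbit_permutes[OF assms C] by (intro sum.cong) auto
    also have "\<dots> = h (card C)" using \<open>card C \<noteq> 0\<close> by simp
    finally show "(\<Sum>x | x \<in> S \<and> orbit f x = C. h (card (orbit f x)) / real (card (orbit f x)))
        = h (card C)" .
  qed
  finally show ?thesis ..
qed

text \<open>By injectivity of \<open>f\<close>, the part of \<open>A\<close> in \<open>C\<close> and
  its image have the same size. Both lie in \<open>C\<close>, and freeness makes them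
  disjoint.\<close>

lemma card_free_subset_orbit_le:
  assumes "f permutes S" "finite S" "C \<in> orbit f ` S" "\<forall>x\<in>A. f x \<notin> A"
  shows "card (A \<inter> C) \<le> card C div 2"
proof -
  have "finite C"
    using assms permutes_orbit_subset[OF assms(1)] by (auto intro: finite_subset)
  have "f ` C \<subseteq> C" using assms(3) by (auto intro: orbit.step)
  have "2 * card (A \<inter> C) = card (A \<inter> C) + card (f ` (A \<inter> C))"
    using permutes_inj[OF assms(1)] by (simp add: card_image inj_on_def)
  also have "\<dots> = card ((A \<inter> C) \<union> f ` (A \<inter> C))"
    using \<open>finite C\<close> assms(4) by (intro card_Un_disjoint[symmetric]) auto
  also have "\<dots> \<le> card C"
    using \<open>finite C\<close> \<open>f ` C \<subseteq> C\<close> by (intro card_mono) auto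
  finally show ?thesis by simp
qed

text \<open>Take the points with odd index, starting the count of the cycle at 0.\<close>

lemma ex_free_subset_orbit:
  assumes "f permutes S" "finite S" "C \<in> orbit f ` S"
  shows "\<exists>B\<subseteq>C. card B = card C div 2 \<and> (\<forall>x\<in>B. f x \<notin> B)"
proof -
  obtain s where s: "s \<in> S" "C = orbit f s" using assms(3) by blast
  define L where "L = funpow_dist1 f s s"
  define g where "g i = (f ^^ i) s" for i
  have self: "s \<in> orbit f s"
    using assms(1,2) by (intro permutation_self_in_orbit) (auto simp: permutation_permutes)
  have C: "C = g ` {0..<L}"
    unfolding s L_def g_def by (rule orbit_conv_funpow_dist1[OF self])
  have inj: "inj_on g {0..<L}"
    unfolding L_def g_def by (rule inj_on_funpow_dist1[OF self])
  have card: "card C = L" using C inj by (simp add: card_image)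
  have gL: "g L = g 0" unfolding L_def g_def using funpow_dist1_prop[OF self] by simp
  have step: "f (g i) = g (Suc i)" for i by (simp add: g_def)
  define J where "J = (\<lambda>i. 2 * i + 1) ` {0..<L div 2}"
  have J: "J \<subseteq> {0..<L}" by (auto simp: J_def)
  have odd: "odd j" if "j \<in> J" for j using that by (auto simp: J_def)
  have "card J = L div 2" unfolding J_def by (subst card_image) (auto simp: inj_on_def)
  moreover have "card (g ` J) = card J"
    using inj J by (intro card_image) (rule inj_on_subset)
  moreover have "f x \<notin> g ` J" if x: "x \<in> g ` J" for x
  proof
    assume "f x \<in> g ` J"
    then obtain i j where ij: "i \<in> J" "j \<in> J" "g (Suc i) = g j"
      using x step by auto
    show False
    \<comment> \<open>Only the last index wraps around, to index 0, which is even and hence outside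
      \<open>J\<close>. Elsewhere consecutive indices have opposite parity.\<close>
    proof (cases "Suc i = L")
      case True
      hence "g 0 = g j" using ij gL by simp
      hence "j = 0" using ij J by (auto dest!: inj_onD[OF inj])
      thus False using odd ij by fastforce
    next
      case False
      hence "Suc i = j" using ij J inj_onD[OF inj ij(3)] by force
      thus False using odd[OF ij(1)] odd[OF ij(2)] by auto
    qed
  qed
  moreover have "g ` J \<subseteq> C" using C J by auto
  ultimately show ?thesis using card by (intro exI[of _ "g ` J"]) auto
qed

text \<open>Orbits partition \<open>S\<close> and \<open>f\<close> maps each into itself, so
  freeness can be treated orbit by orbit: the upper bounds add up, and a union of optimal choices is
  again free.\<close>

lemma Max_card_free_permutes:
  assumes f: "f permutes S" and fin: "finite S"
  shows "Max (card ` {A. A \<subseteq> S \<and> (\<forall>x\<in>A. f x \<notin> A)}) = (\<Sum>C\<in>orbit f ` S. card C div 2)"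
proof (rule Max_eqI)
  show "finite (card ` {A. A \<subseteq> S \<and> (\<forall>x\<in>A. f x \<notin> A)})"
    using fin by (intro finite_imageI finite_subset[OF _ finite_Pow_iff[THEN iffD2, OF fin]]) auto
next
  fix c assume "c \<in> card ` {A. A \<subseteq> S \<and> (\<forall>x\<in>A. f x \<notin> A)}"
  then obtain A where A: "c = card A" "A \<subseteq> S" "\<forall>x\<in>A. f x \<notin> A" by blast
  show "c \<le> (\<Sum>C\<in>orbit f ` S. card C div 2)"
    unfolding A(1) card_subset_eq_sum_orbits[OF f fin A(2)]
    by (intro sum_mono card_free_subset_orbit_le[OF f fin _ A(3)])
next
  obtain B where B: "\<And>C. C \<in> orbit f ` S \<Longrightarrow>
      B C \<subseteq> C \<and> card (B C) = card C div 2 \<and> (\<forall>x\<in>B C. f x \<notin> B C)"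
    using ex_free_subset_orbit[OF f fin] by metis
  define A where "A = (\<Union>C\<in>orbit f ` S. B C)"
  have sub: "C \<subseteq> S" if "C \<in> orbit f ` S" for C
    using that permutes_orbit_subset[OF f] by auto
  have AS: "A \<subseteq> S" unfolding A_def using B sub by blast
  have disj: "C = D" if "C \<in> orbit f ` S" "D \<in> orbit f ` S" "x \<in> C" "x \<in> D" for C D x
    using that orbit_eq_iff_permutes[OF f fin] by blast
  \<comment> \<open>As orbits are disjoint, no other \<open>B D\<close> reaches into
    \<open>C\<close>. Both the freeness of \<open>A\<close> and its cardinality rest on
    this.\<close>
  have AC: "A \<inter> C = B C" if C: "C \<in> orbit f ` S" for C
  proof
    show "B C \<subseteq> A \<inter> C" using B[OF C] C by (auto simp: A_def)
    show "A \<inter> C \<subseteq> B C"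
    proof
      fix x assume "x \<in> A \<inter> C"
      then obtain D where D: "D \<in> orbit f ` S" "x \<in> B D" "x \<in> C"
        unfolding A_def by blast
      with disj[OF D(1) C, of x] B[OF D(1)] show "x \<in> B C" by blast
    qed
  qed
  have "f x \<notin> A" if x: "x \<in> A" for x
  proof
    assume fx: "f x \<in> A"
    obtain C where C: "C \<in> orbit f ` S" "x \<in> B C" using x unfolding A_def by blast
    obtain s where "C = orbit f s" using C(1) by blast
    hence "f x \<in> C" using C B[OF C(1)] orbit.step[of x f s] by blast
    thus False using AC[OF C(1)] B[OF C(1)] C fx by blast
  qed
  moreover have "card A = (\<Sum>C\<in>orbit f ` S. card C div 2)"
    unfolding card_subset_eq_sum_orbits[OF f fin AS] using AC B by (intro sum.cong) auto
  ultimately show "(\<Sum>C\<in>orbit f ` S. card C div 2) \<in> card ` {A. A \<subseteq> S \<and> (\<forall>x\<in>A. f x \<notin> A)}"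
    using AS by (intro image_eqI[of _ _ A]) auto
qed

section \<open>Periods, and counting residues by their gcd with the modulus\<close>

lemma card_orbit_of_period:
  assumes "m > 0" "\<And>i. (f ^^ i) x = x \<longleftrightarrow> m dvd i"
  shows "card (orbit f x) = m"
proof -
  have m: "(f ^^ m) x = x" by (simp add: assms)
  have "inj_on (\<lambda>i. (f ^^ i) x) {0..<m}"
    using m assms by (intro inj_on_funpow_least) (auto dest: dvd_imp_le)
  moreover have "orbit f x = (\<lambda>i. (f ^^ i) x) ` {0..<m}"
    using orbit_altdef_bounded[OF m assms(1)] by auto
  ultimately show ?thesis by (simp add: card_image)
qed

text \<open>Dividing \<open>y\<close> and \<open>n\<close> by their gcd leaves a cofactor of
  \<open>y\<close> coprime to the reduced modulus, so this cofactor cancels as well.\<close>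

lemma cong_mult_self_iff:
  fixes n a y :: nat
  assumes "n > 0"
  shows "[a * y = y] (mod n) \<longleftrightarrow> [a = 1] (mod (n div gcd y n))"
proof -
  define g where "g = gcd y n"
  have g: "g > 0" using assms by (simp add: g_def)
  obtain y' n' where y': "y = y' * g" "n = n' * g" and cop: "coprime y' n'"
    using gcd_coprime_exists[of y n] g unfolding g_def by blast
  have "[a * y = y] (mod n) \<longleftrightarrow> [a * y' * g = 1 * y' * g] (mod (n' * g))"
    by (simp add: y' mult_ac)
  also have "\<dots> \<longleftrightarrow> [a * y' = 1 * y'] (mod n')"
    using g by (simp add: cong_def mult_mod_left[symmetric])
  also have "\<dots> \<longleftrightarrow> [a = 1] (mod n')"
    using cop by (rule cong_mult_rcancel_nat)
  also have "n' = n div g" using g y' by simp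
  finally show ?thesis by (simp add: g_def)
qed

text \<open>Group by \<open>e = gcd y n\<close>, a value taken \<open>totient (n div e)\<close>
  times on \<open>{0<..n}\<close>, then substitute \<open>d = n div e\<close>, an involution on the
  divisors.\<close>

lemma sum_gcd_eq_sum_totient:
  fixes h :: "nat \<Rightarrow> real"
  assumes "n > 0"
  shows "(\<Sum>y\<in>{0<..n}. h (n div gcd y n)) = (\<Sum>d | d dvd n. real (totient d) * h d)"
proof -
  have "(\<Sum>y\<in>{0<..n}. h (n div gcd y n)) =
      (\<Sum>e | e dvd n. \<Sum>y | y \<in> {0<..n} \<and> gcd y n = e. h (n div gcd y n))"
    using assms by (subst sum.group) auto
  also have "\<dots> = (\<Sum>e | e dvd n. real (totient (n div e)) * h (n div e))"
    using card_gcd_eq_totient[OF assms] by (intro sum.cong) auto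
  also have "\<dots> = (\<Sum>d | d dvd n. real (totient d) * h d)"
    using assms by (intro sum.reindex_bij_witness[of _ "(div) n" "(div) n"]) (auto elim: dvdE)
  finally show ?thesis .
qed

section \<open>Multiplication by \<open>k\<close> as a permutation of residues\<close>

text \<open>The identity from \<open>n\<close> on, as \<open>permutes\<close> demands.\<close>

definition mult_perm :: "nat \<Rightarrow> nat \<Rightarrow> nat \<Rightarrow> nat" where
  "mult_perm n k y = (if y < n then k * y mod n else y)"

lemma mult_perm_permutes:
  assumes "coprime k n" "n > 0"
  shows "mult_perm n k permutes {..<n}"
proof (rule bij_imp_permutes)
  have "inj_on (mult_perm n k) {..<n}"
    using assms by (auto simp: inj_on_def mult_perm_def cong_mult_lcancel_nat simp flip: cong_def
        dest: cong_less_modulus_unique_nat)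
  moreover have "mult_perm n k ` {..<n} \<subseteq> {..<n}"
    using assms by (auto simp: mult_perm_def)
  ultimately show "bij_betw (mult_perm n k) {..<n} {..<n}"
    by (simp add: bij_betw_def endo_inj_surj)
qed (simp add: mult_perm_def)

lemma funpow_mult_perm:
  assumes "y < n"
  shows "(mult_perm n k ^^ i) y = k ^ i * y mod n"
proof (induction i)
  case (Suc i)
  with assms show ?case by (simp add: mult_perm_def mod_mult_right_eq mult.assoc)
qed (use assms in simp)

text \<open>The \<open>i\<close>-th iterate fixes \<open>y\<close> iff \<open>k ^ i\<close> is 1
  modulo \<open>n div gcd y n\<close>, so the periods of \<open>y\<close> are the multiples of that
  order.\<close>

lemma card_orbit_mult_perm:
  assumes "coprime k n" "y < n"
  shows "card (orbit (mult_perm n k) y) = ord (n div gcd y n) k"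
proof (rule card_orbit_of_period)
  have "n div gcd y n dvd n"
    using dvd_div_mult_self[OF gcd_dvd2[of y n]] by (metis dvd_triv_left)
  \<comment> \<open>Without coprimality \<open>ord\<close> takes the default value 0, which is no
    cycle length.\<close>
  hence "coprime (n div gcd y n) k"
    using assms(1) by (meson coprime_commute coprime_divisors dvd_refl)
  thus "0 < ord (n div gcd y n) k"
    by simp
next
  fix i
  have "(mult_perm n k ^^ i) y = y \<longleftrightarrow> [k ^ i * y = y] (mod n)"
    using assms by (simp add: funpow_mult_perm cong_def)
  also have "\<dots> \<longleftrightarrow> ord (n div gcd y n) k dvd i"
    using assms by (simp add: cong_mult_self_iff ord_divides ord_divides')
  finally show "(mult_perm n k ^^ i) y = y \<longleftrightarrow> ord (n div gcd y n) k dvd i" .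
qed

text \<open>The injection \<open>int\<close> carries natural residues to the integer ones of
  \<open>k_free\<close>, intertwines the two multiplications and preserves cardinalities.\<close>

lemma card_image_k_free:
  assumes "n > 0"
  shows "card ` {A. k_free k n A} = card ` {A. A \<subseteq> {..<n} \<and> (\<forall>y\<in>A. mult_perm n k y \<notin> A)}"
    (is "card ` ?L = card ` ?R")
proof -
  have int_mult_perm: "int (mult_perm n k y) = int k * int y mod int n" if "y < n" for y
    using that by (simp add: mult_perm_def zmod_int)
  have "?L = (`) int ` ?R"
  proof (intro equalityI subsetI)
    fix A assume "A \<in> ?L"
    hence A: "A \<subseteq> {0..int n - 1}" "\<forall>x\<in>A. (int k * x) mod int n \<notin> A"
      using assms by (auto simp: k_free_def residue_ring_def)
    define B where "B = {y. int y \<in> A}"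
    have AB: "A = int ` B"
      using A(1) by (force simp: B_def image_iff intro: exI[of _ "nat x" for x])
    have "B \<in> ?R"
      using A int_mult_perm by (fastforce simp: B_def)
    thus "A \<in> (`) int ` ?R" using AB by blast
  next
    fix A assume "A \<in> (`) int ` ?R"
    then obtain B where B: "A = int ` B" "B \<subseteq> {..<n}" "\<forall>y\<in>B. mult_perm n k y \<notin> B" by blast
    have "int k * int y mod int n \<notin> int ` B" if "y \<in> B" for y
      using B that int_mult_perm[of y] by (metis image_iff lessThan_iff of_nat_eq_iff subsetD)
    thus "A \<in> ?L" using B by (force simp: k_free_def residue_ring_def)
  qed
  thus ?thesis by (simp add: image_image card_image)
qed

theorem theorem1:
  fixes n k :: nat
  assumes "n \<ge> 1" and "k \<ge> 1" and "gcd n k = 1"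
  shows "real (max_k_free k n) =
    (real n - 1) / 2 -
    (\<Sum>d | d dvd n \<and> d \<noteq> 1.
       real (totient d) * indicator {t. odd t} (ord d k) / (2 * real (ord d k)))"
proof -
  have n: "n > 0" using assms(1) by simp
  have cop: "coprime k n" using gcd_eq_1_imp_coprime[OF assms(3)] by (simp add: coprime_commute)
  define p where "p = mult_perm n k"
  have p: "p permutes {..<n}" unfolding p_def by (rule mult_perm_permutes[OF cop n])
  \<comment> \<open>\<open>h\<close> is the weight of a point on a cycle of length \<open>L\<close>;
    \<open>w\<close> is its deficit from 1/2, which only odd cycles have.\<close>
  define h where "h L = real (L div 2) / real L" for L :: nat
  define w where "w L = indicator {t. odd t} L / (2 * real L)" for L :: nat
  have h: "h L = 1 / 2 - w L" if "L > 0" for L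
    using that by (cases "even L") (auto simp: h_def w_def field_simps real_of_nat_div elim!: oddE)
  \<comment> \<open>The divisor 1 belongs to the residue 0, a fixed point, which no
    \<open>k\<close>-free set contains. Hence its term drops out below.\<close>
  have h1: "h (ord 1 k) = 0" by (simp add: h_def)
  have pos: "ord d k > 0" if "d dvd n" for d
    using that cop coprime_divisors[of d n k k] by (simp add: coprime_commute)
  have fin: "finite {d. d dvd n}" using n by simp
  have "real (max_k_free k n) = (\<Sum>C\<in>orbit p ` {..<n}. real (card C div 2))"
    unfolding max_k_free_def card_image_k_free[OF n] p_def[symmetric]
    by (simp add: Max_card_free_permutes[OF p])
  also have "\<dots> = (\<Sum>y\<in>{..<n}. h (card (orbit p y)))"
    unfolding h_def using p by (rule sum_orbits_eq_sum[where h = "\<lambda>L. real (L div 2)"]) simp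
  also have "\<dots> = (\<Sum>y\<in>{..<n}. h (ord (n div gcd y n) k))"
    using card_orbit_mult_perm[OF cop] by (intro sum.cong) (auto simp: p_def)
  \<comment> \<open>The representative 0 is exchanged for \<open>n\<close>; both have gcd
    \<open>n\<close> with \<open>n\<close>.\<close>
  also have "\<dots> = (\<Sum>y\<in>{0<..n}. h (ord (n div gcd y n) k))"
    using n by (intro sum.reindex_bij_witness[of _ "\<lambda>y. y mod n" "\<lambda>y. if y = 0 then n else y"])
      (auto simp: le_less)
  also have "\<dots> = (\<Sum>d | d dvd n. real (totient d) * h (ord d k))"
    using n by (rule sum_gcd_eq_sum_totient[where h = "\<lambda>d. h (ord d k)"])
  also have "\<dots> = (\<Sum>d | d dvd n \<and> d \<noteq> 1. real (totient d) * h (ord d k))"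
    using fin h1 by (intro sum.mono_neutral_right) auto
  also have "\<dots> = (\<Sum>d | d dvd n \<and> d \<noteq> 1. real (totient d) / 2 - real (totient d) * w (ord d k))"
    by (intro sum.cong) (simp_all add: h[OF pos] right_diff_distrib)
  also have "\<dots> = real (\<Sum>d | d dvd n \<and> d \<noteq> 1. totient d) / 2 -
      (\<Sum>d | d dvd n \<and> d \<noteq> 1. real (totient d) * w (ord d k))"
    by (simp add: sum_subtractf sum_divide_distrib)
  \<comment> \<open>The totients of all divisors sum to \<open>n\<close>, and the omitted divisor 1
    accounts for 1.\<close>
  also have "real (\<Sum>d | d dvd n \<and> d \<noteq> 1. totient d) = real n - 1"
  proof -
    have "{d. d dvd n} = insert 1 {d. d dvd n \<and> d \<noteq> 1}" by auto
    hence "n = 1 + (\<Sum>d | d dvd n \<and> d \<noteq> 1. totient d)"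
      using totient_divisor_sum[of n] fin by simp
    thus ?thesis by linarith
  qed
  finally show ?thesis by (simp add: w_def)
qed

end
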